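(* Let $f,g:\mathbb{R}^d\to\mathbb{R}$ be twice differentiable, let $\epsilon,\beta>0$, let $\sigma_\beta(x)=\frac{1}{1+\exp(-\beta x)}$, and consider the ODE $\dot w=-F(w)$ with $$F(w)=\sigma_\beta(g(w)-\epsilon)\,\nabla g(w)+[1-\sigma_\beta(g(w)-\epsilon)]\,\nabla f(w).$$ Then the Jacobian $J_F(w)$ of $F$ at $w$ is $$J_F(w)=\nabla^2 f(w)+\sigma_\beta(g(w)-\epsilon)\big(\nabla^2 g(w)-\nabla^2 f(w)\big)+\sigma_\beta'(g(w)-\epsilon)\big(\nabla g(w)-\nabla f(w)\big)(\nabla g(w))^\top .$$ Consequently, whenever $\nabla g(w)$ and $\nabla f(w)$ are linearly independent, $J_F(w)$ has a skew-symmetric component, i.e. its skew-symmetric part $\frac12\big(J_F(w)-J_F(w)^\top\big)$ is nonzero.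
   Context: $\nabla^2$ denotes the (symmetric) Hessian and $\sigma_\beta'$ the derivative of $\sigma_\beta$. *)

theory Defs
  imports "HOL-Analysis.Analysis"
begin

definition grad :: "(real^'n \<Rightarrow> real) \<Rightarrow> real^'n \<Rightarrow> real^'n" where
  "grad f x = (THE D. GDERIV f x :> D)"

lemma grad_eqI:
  assumes D: "GDERIV f x :> D"
  shows "grad f x = D"
  unfolding grad_def
proof (rule the_equality)
  show "GDERIV f x :> D" by (rule D)
next
  fix D' assume D': "GDERIV f x :> D'"
  have "(\<lambda>h. h \<bullet> D') = (\<lambda>h. h \<bullet> D)"
    by (rule has_derivative_unique[OF D'[unfolded gderiv_def] D[unfolded gderiv_def]])
  then have "\<forall>h. h \<bullet> D' = h \<bullet> D" by (rule fun_cong[THEN allI])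
  then show "D' = D" by (simp only: vector_eq_ldot)
qed

lemma GDERIV_grad:
  fixes f :: "real^'n \<Rightarrow> real"
  assumes "f differentiable (at x)"
  shows "GDERIV f x :> grad f x"
proof -
  obtain f' where f': "(f has_derivative f') (at x)"
    using assms unfolding differentiable_def by blast
  have lin: "linear f'" using f' by (rule has_derivative_linear)
  have "f' h = h \<bullet> adjoint f' 1" for h
    using adjoint_works[OF lin, of h 1] by simp
  then have "f' = (\<lambda>h. h \<bullet> adjoint f' 1)" by (rule ext)
  with f' have G: "GDERIV f x :> adjoint f' 1"
    unfolding gderiv_def by (rule back_subst[where P = "\<lambda>q. (f has_derivative q) (at x)"])
  show ?thesis unfolding grad_eqI[OF G] by (rule G)
qed

text \<open>
  Twice differentiable in the Frechet sense, everywhere; the second derivatives need not be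
  continuous. Differentiability of the gradient is differentiability of the first derivative, via
  the inner product.
\<close>
definition twice_differentiable :: "(real^'n \<Rightarrow> real) \<Rightarrow> bool" where
  "twice_differentiable f \<longleftrightarrow>
     (\<forall>x. f differentiable (at x)) \<and> (\<forall>x. grad f differentiable (at x))"

text \<open>Symmetry of this matrix is a theorem about twice differentiable functions,
  not part of the definition.\<close>
definition hessian :: "(real^'n \<Rightarrow> real) \<Rightarrow> real^'n \<Rightarrow> real^'n^'n" where
  "hessian f x = jacobian (grad f) (at x)"

definition outer :: "real^'m \<Rightarrow> real^'n \<Rightarrow> real^'n^'m" where
  "outer u v = (\<chi> i j. u $ i * v $ j)"

definition sigmoid :: "real \<Rightarrow> real \<Rightarrow> real" where
  "sigmoid \<beta> x = 1 / (1 + exp (- \<beta> * x))"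

text \<open>The flow under consideration is the ODE \<open>w' = - switched_field f g \<epsilon> \<beta> w\<close>.\<close>
definition switched_field ::
  "(real^'n \<Rightarrow> real) \<Rightarrow> (real^'n \<Rightarrow> real) \<Rightarrow> real \<Rightarrow> real \<Rightarrow> real^'n \<Rightarrow> real^'n" where
  "switched_field f g \<epsilon> \<beta> w =
     sigmoid \<beta> (g w - \<epsilon>) *\<^sub>R grad g w + (1 - sigmoid \<beta> (g w - \<epsilon>)) *\<^sub>R grad f w"

definition skew_part :: "real^'n^'n \<Rightarrow> real^'n^'n" where
  "skew_part A = (1/2) *\<^sub>R (A - transpose A)"

text \<open>Linear independence of the pair \<open>(u, v)\<close> as a family: the set \<open>{u, v}\<close> alone would not
  detect \<open>u = v\<close>.\<close>
definition independent_pair :: "real^'n \<Rightarrow> real^'n \<Rightarrow> bool" where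
  "independent_pair u v \<longleftrightarrow> u \<noteq> v \<and> independent {u, v}"

end

theory Submission
  imports Defs
begin

text \<open>
  Differentiating the field by the product and chain rules gives the formula for the Jacobian.
  Both Hessians are symmetric, so they do not contribute to the skew part, which is therefore a
  positive multiple of \<open>a b\<^sup>T - b a\<^sup>T\<close> with \<open>a = \<nabla>g - \<nabla>f\<close> and \<open>b = \<nabla>g\<close>. This vanishes only if
  \<open>a\<close> and \<open>b\<close> are parallel. As second derivatives need not be continuous, symmetry of the Hessian
  is derived from differentiability of the gradient at the single point in question.
\<close>

text \<open>
  Apply the mean value theorem to \<open>s \<mapsto> f (x + s u + t v) - f (x + s u)\<close> on \<open>[0, t]\<close>: the second
  difference over \<open>t\<^sup>2\<close> tends to \<open>A v \<bullet> u\<close>, although it is symmetric in \<open>u\<close> and \<open>v\<close>.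
\<close>

lemma second_difference_estimate:
  fixes f :: "'a::real_inner \<Rightarrow> real"
  assumes f: "\<And>y. GDERIV f y :> G y" and G: "(G has_derivative A) (at x)" and e: "e > 0"
  obtains d where "d > 0"
    and "\<And>t. 0 < t \<Longrightarrow> t < d \<Longrightarrow>
      \<bar>f (x + t *\<^sub>R u + t *\<^sub>R v) - f (x + t *\<^sub>R u) - f (x + t *\<^sub>R v) + f x - t\<^sup>2 * (A v \<bullet> u)\<bar> \<le> e * t\<^sup>2"
proof -
  \<comment> \<open>\<open>t * M\<close> will bound both displacements \<open>s *\<^sub>R u\<close>
    and \<open>s *\<^sub>R u + t *\<^sub>R v\<close> for 0 < s < t. The summand 1 keeps
    \<open>M\<close> positive when both vectors vanish.\<close>
  define M where "M = norm u + norm v + 1"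
  have M: "M > 0" "norm u \<le> M" "norm u + norm v \<le> M"
    by (auto simp: M_def add_nonneg_pos)
  \<comment> \<open>Two remainders of size \<open>e' * (t * M)\<close>, paired with \<open>u\<close>
    of norm at most \<open>M\<close> and multiplied by \<open>t\<close>, then total at most
    \<open>e * t\<^sup>2\<close>.\<close>
  define e' where "e' = e / (2 * M\<^sup>2)"
  have e': "e' > 0" using e M by (simp add: e'_def)
  interpret A: bounded_linear A using G by (rule has_derivative_bounded_linear)
  obtain d where d: "d > 0"
    and dG: "\<And>y. norm (y - x) < d \<Longrightarrow> norm (G y - G x - A (y - x)) \<le> e' * norm (y - x)"
    using G e' unfolding has_derivative_at_alt by blast
  have near: "norm (G (x + k) - G x - A k) \<le> e' * (t * M)"
    if t: "0 < t" "t < d / M" and k: "norm k \<le> t * M" for t k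
  proof -
    have "t * M < d" using t M by (simp add: field_simps)
    then have "norm (G (x + k) - G x - A k) \<le> e' * norm k"
      using dG[of "x + k"] k by simp
    also have "\<dots> \<le> e' * (t * M)" using k e' by simp
    finally show ?thesis .
  qed
  show thesis
  proof (rule that)
    show "d / M > 0" using d M by simp
    fix t :: real assume t: "0 < t" "t < d / M"
    define p where "p s = f (x + s *\<^sub>R u + t *\<^sub>R v) - f (x + s *\<^sub>R u)" for s
    have p': "(p has_real_derivative (G (x + s *\<^sub>R u + t *\<^sub>R v) - G (x + s *\<^sub>R u)) \<bullet> u) (at s)" for s
    proof -
      have D: "(f has_derivative (\<lambda>h. h \<bullet> G y)) (at y)" for y
        using f by (simp add: gderiv_def)
      show ?thesis
        unfolding p_def has_field_derivative_def
        by (auto intro!: derivative_eq_intros has_derivative_compose[OF _ D]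
            simp: inner_diff_left inner_commute algebra_simps)
    qed
    obtain s where s: "0 < s" "s < t"
      and mvt: "p t - p 0 = (t - 0) * ((G (x + s *\<^sub>R u + t *\<^sub>R v) - G (x + s *\<^sub>R u)) \<bullet> u)"
      using MVT2[of 0 t p "\<lambda>s. (G (x + s *\<^sub>R u + t *\<^sub>R v) - G (x + s *\<^sub>R u)) \<bullet> u"] p' t by blast
    \<comment> \<open>Since \<open>G\<close> is known to be differentiable only at \<open>x\<close>,
      both gradients in the mean value formula are expanded around \<open>x\<close>; their common
      term \<open>A (s *\<^sub>R u)\<close> cancels.\<close>
    define R where "R k = G (x + k) - G x - A k" for k
    have su: "norm (s *\<^sub>R u) \<le> t * norm u"
      using s by (simp add: mult_right_mono)
    have n1: "norm (R (s *\<^sub>R u)) \<le> e' * (t * M)"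
    proof -
      have "norm (s *\<^sub>R u) \<le> t * M"
        using su mult_left_mono[OF M(2), of t] t by linarith
      then show ?thesis unfolding R_def by (rule near[OF t])
    qed
    have n2: "norm (R (s *\<^sub>R u + t *\<^sub>R v)) \<le> e' * (t * M)"
    proof -
      have "norm (s *\<^sub>R u + t *\<^sub>R v) \<le> norm (s *\<^sub>R u) + norm (t *\<^sub>R v)"
        by (rule norm_triangle_ineq)
      also have "\<dots> \<le> t * (norm u + norm v)"
        using su t by (simp add: algebra_simps)
      also have "\<dots> \<le> t * M" using M t by simp
      finally show ?thesis unfolding R_def by (rule near[OF t])
    qed
    have G_diff: "G (x + s *\<^sub>R u + t *\<^sub>R v) - G (x + s *\<^sub>R u) = t *\<^sub>R A v + (R (s *\<^sub>R u + t *\<^sub>R v) - R (s *\<^sub>R u))"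
      by (simp add: R_def A.add A.scaleR add.assoc)
    have "p t - p 0 - t\<^sup>2 * (A v \<bullet> u) = t * ((R (s *\<^sub>R u + t *\<^sub>R v) - R (s *\<^sub>R u)) \<bullet> u)"
      unfolding mvt G_diff by (simp add: inner_add_left power2_eq_square algebra_simps)
    also have "\<bar>\<dots>\<bar> \<le> t * (norm (R (s *\<^sub>R u + t *\<^sub>R v) - R (s *\<^sub>R u)) * norm u)"
      using t by (simp add: abs_mult Cauchy_Schwarz_ineq2)
    also have "\<dots> \<le> t * ((2 * e' * (t * M)) * M)"
      using t M e' n1 n2 norm_triangle_ineq4[of "R (s *\<^sub>R u + t *\<^sub>R v)" "R (s *\<^sub>R u)"]
      by (intro mult_left_mono mult_mono) auto
    also have "\<dots> = e * t\<^sup>2"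
      using M by (simp add: e'_def power2_eq_square)
    finally show "\<bar>f (x + t *\<^sub>R u + t *\<^sub>R v) - f (x + t *\<^sub>R u) - f (x + t *\<^sub>R v) + f x - t\<^sup>2 * (A v \<bullet> u)\<bar> \<le> e * t\<^sup>2"
      by (simp add: p_def algebra_simps)
  qed
qed

text \<open>Exchanging \<open>u\<close> and \<open>v\<close> leaves the second difference unchanged,
  so for small t both numbers lie within e/2 of the same quotient.\<close>

lemma gradient_derivative_symmetric:
  fixes f :: "'a::real_inner \<Rightarrow> real"
  assumes "\<And>y. GDERIV f y :> G y" and "(G has_derivative A) (at x)"
  shows "A v \<bullet> u = A u \<bullet> v"
proof -
  \<comment> \<open>The shape \<open>0 + e\<close> is the one that \<open>field_le_epsilon\<close>
    takes.\<close>
  have "\<bar>A v \<bullet> u - A u \<bullet> v\<bar> \<le> 0 + e" if e: "e > 0" for e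
  proof -
    let ?D = "\<lambda>t. f (x + t *\<^sub>R u + t *\<^sub>R v) - f (x + t *\<^sub>R u) - f (x + t *\<^sub>R v) + f x"
    have e2: "e / 2 > 0" using e by simp
    obtain d where d: "d > 0"
      "\<And>t. 0 < t \<Longrightarrow> t < d \<Longrightarrow> \<bar>?D t - t\<^sup>2 * (A v \<bullet> u)\<bar> \<le> e / 2 * t\<^sup>2"
      using second_difference_estimate[OF assms e2, of u v] by blast
    obtain d' where d': "d' > 0"
      "\<And>t. 0 < t \<Longrightarrow> t < d' \<Longrightarrow>
        \<bar>f (x + t *\<^sub>R v + t *\<^sub>R u) - f (x + t *\<^sub>R v) - f (x + t *\<^sub>R u) + f x - t\<^sup>2 * (A u \<bullet> v)\<bar> \<le> e / 2 * t\<^sup>2"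
      using second_difference_estimate[OF assms e2, of v u] by blast
    define t where "t = min d d' / 2"
    have t: "0 < t" "t < d" "t < d'" using d(1) d'(1) by (auto simp: t_def)
    have swap: "x + t *\<^sub>R v + t *\<^sub>R u = x + t *\<^sub>R u + t *\<^sub>R v" by simp
    have "\<bar>t\<^sup>2 * (A v \<bullet> u) - t\<^sup>2 * (A u \<bullet> v)\<bar> \<le> e * t\<^sup>2"
      using d(2)[OF t(1,2)] d'(2)[OF t(1,3)] unfolding swap by linarith
    then have "t\<^sup>2 * \<bar>A v \<bullet> u - A u \<bullet> v\<bar> \<le> t\<^sup>2 * e"
      by (simp add: abs_mult mult.commute[of e] flip: right_diff_distrib)
    then show ?thesis using t by simp
  qed
  then have "\<bar>A v \<bullet> u - A u \<bullet> v\<bar> \<le> 0" by (rule field_le_epsilon)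
  then show ?thesis by simp
qed

lemma has_derivative_grad:
  assumes "twice_differentiable f"
  shows "(grad f has_derivative (\<lambda>h. hessian f x *v h)) (at x)"
  using assms by (simp add: twice_differentiable_def hessian_def jacobian_works)

lemma has_derivative_inner_grad:
  assumes "twice_differentiable f"
  shows "(f has_derivative (\<lambda>h. h \<bullet> grad f x)) (at x)"
  using assms GDERIV_grad by (auto simp: twice_differentiable_def gderiv_def)

lemma transpose_hessian:
  assumes "twice_differentiable f"
  shows "transpose (hessian f x) = hessian f x"
proof -
  have "(hessian f x *v v) \<bullet> u = (hessian f x *v u) \<bullet> v" for u v
    using has_derivative_inner_grad[OF assms] has_derivative_grad[OF assms]
    by (intro gradient_derivative_symmetric[where f = f and G = "grad f"]) (auto simp: gderiv_def)
  \<comment> \<open>On basis vectors the bilinear form returns the matrix entries.\<close>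
  from this[of "axis j 1" "axis i 1" for i j] show ?thesis
    by (simp add: vec_eq_iff transpose_def matrix_vector_mult_basis column_def inner_axis)
qed

lemma outer_mult_vec: "outer u v *v h = (h \<bullet> v) *\<^sub>R u"
  by (simp add: vec_eq_iff outer_def matrix_vector_mult_def inner_vec_def sum_distrib_left mult_ac)

text \<open>Apply both matrices to \<open>b\<close>: the left one yields a multiple of
  \<open>a\<close>, its transpose \<open>outer b a\<close> a multiple of \<open>b\<close>.\<close>

lemma outer_eq_transpose_imp_parallel:
  assumes "outer a b = transpose (outer a b)"
  shows "(b \<bullet> b) *\<^sub>R a = (a \<bullet> b) *\<^sub>R b"
proof -
  have "transpose (outer a b) = outer b a"
    by (simp add: vec_eq_iff outer_def transpose_def mult.commute)
  with assms have "outer a b *v b = outer b a *v b" by simp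
  then show ?thesis by (simp add: outer_mult_vec inner_commute)
qed

text \<open>Excludes the conclusion of the previous lemma for \<open>a = u - v\<close> and
  \<open>b = u\<close>: dividing by the nonzero \<open>u \<bullet> u\<close> would put
  \<open>v\<close> into the span of \<open>u\<close>.\<close>

lemma independent_pair_not_parallel:
  assumes "independent_pair u v"
  shows "(u \<bullet> u) *\<^sub>R (u - v) \<noteq> c *\<^sub>R u"
proof
  have "u \<noteq> v" and ind: "independent {u, v}"
    using assms by (auto simp: independent_pair_def)
  have "u \<noteq> 0" using ind dependent_zero by blast
  assume "(u \<bullet> u) *\<^sub>R (u - v) = c *\<^sub>R u"
  then have "(u \<bullet> u) *\<^sub>R v = (u \<bullet> u - c) *\<^sub>R u"
    by (simp add: algebra_simps)
  then have "(1 / (u \<bullet> u)) *\<^sub>R ((u \<bullet> u) *\<^sub>R v) = ((u \<bullet> u - c) / (u \<bullet> u)) *\<^sub>R u"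
    by simp
  then have "v = ((u \<bullet> u - c) / (u \<bullet> u)) *\<^sub>R u" using \<open>u \<noteq> 0\<close> by simp
  then have "v \<in> span {u}" by (metis span_base span_scale singletonI)
  \<comment> \<open>Distinctness keeps \<open>{u, v}\<close> from collapsing to a singleton, whose
    independence would not separate \<open>v\<close> from the span of \<open>u\<close>.\<close>
  moreover have "v \<notin> span {u}"
    using ind \<open>u \<noteq> v\<close> by (auto simp: insert_commute[of u] independent_insert)
  ultimately show False by contradiction
qed

lemma has_real_derivative_sigmoid:
  "(sigmoid \<beta> has_real_derivative \<beta> * exp (- \<beta> * x) / (1 + exp (- \<beta> * x))\<^sup>2) (at x)"
proof -
  have "1 + exp (- \<beta> * x) \<noteq> 0" by (metis add_pos_pos exp_gt_zero less_irrefl zero_less_one)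
  then show ?thesis unfolding sigmoid_def
    by (auto intro!: derivative_eq_intros simp: power2_eq_square)
qed

text \<open>Keeps the coefficient of the rank-one term from vanishing; this is where positivity of
  \<open>\<beta>\<close> enters.\<close>

lemma deriv_sigmoid_pos: "\<beta> > 0 \<Longrightarrow> deriv (sigmoid \<beta>) x > 0"
  unfolding DERIV_imp_deriv[OF has_real_derivative_sigmoid]
  by (intro divide_pos_pos mult_pos_pos zero_less_power add_pos_pos) auto

text \<open>To be used with the Hessian terms as \<open>S\<close> and the outer product as
  \<open>B\<close>.\<close>

lemma skew_part_symmetric_plus:
  assumes "transpose S = S"
  shows "skew_part (S + c *\<^sub>R B) = (c / 2) *\<^sub>R (B - transpose B)"
  using assms by (simp add: skew_part_def vec_eq_iff transpose_def algebra_simps)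

text \<open>The weights of the two gradients have opposite derivatives along \<open>h\<close>, which
  together contribute \<open>h \<bullet> grad g w\<close> times a multiple of
  \<open>grad g w - grad f w\<close>: the outer product applied to \<open>h\<close>.\<close>

lemma has_derivative_switched_field:
  assumes f: "twice_differentiable f" and g: "twice_differentiable g"
  shows "(switched_field f g \<epsilon> \<beta> has_derivative (*v)
      (hessian f w
       + sigmoid \<beta> (g w - \<epsilon>) *\<^sub>R (hessian g w - hessian f w)
       + deriv (sigmoid \<beta>) (g w - \<epsilon>) *\<^sub>R outer (grad g w - grad f w) (grad g w))) (at w)"
proof -
  let ?s = "\<lambda>w. sigmoid \<beta> (g w - \<epsilon>)" and ?s' = "deriv (sigmoid \<beta>) (g w - \<epsilon>)"
  have S: "(sigmoid \<beta> has_derivative (\<lambda>h. ?s' * h)) (at (g w - \<epsilon>))"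
    using has_real_derivative_sigmoid DERIV_imp_deriv[OF has_real_derivative_sigmoid]
    by (metis has_field_derivative_def)
  have "((\<lambda>w. g w - \<epsilon>) has_derivative (\<lambda>h. h \<bullet> grad g w)) (at w)"
    using has_derivative_inner_grad[OF g] by (auto intro!: derivative_eq_intros)
  from has_derivative_compose[OF this S]
  have s: "(?s has_derivative (\<lambda>h. ?s' * (h \<bullet> grad g w))) (at w)" .
  show ?thesis
    unfolding switched_field_def
    by (rule derivative_eq_intros s has_derivative_grad[OF f] has_derivative_grad[OF g] refl)+
      (simp add: fun_eq_iff outer_mult_vec algebra_simps matrix_vector_mult_add_rdistrib
        matrix_vector_mult_diff_rdistrib flip: scaleR_matrix_vector_assoc)
qed

theorem proposition1:
  fixes f g :: "real^'n \<Rightarrow> real" and \<epsilon> \<beta> :: real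
  assumes "twice_differentiable f" and "twice_differentiable g"
    and "\<epsilon> > 0" and "\<beta> > 0"
  shows "\<forall>w. (switched_field f g \<epsilon> \<beta> differentiable (at w) \<and>
           jacobian (switched_field f g \<epsilon> \<beta>) (at w) =
             hessian f w
             + sigmoid \<beta> (g w - \<epsilon>) *\<^sub>R (hessian g w - hessian f w)
             + deriv (sigmoid \<beta>) (g w - \<epsilon>) *\<^sub>R outer (grad g w - grad f w) (grad g w)) \<and>
         (independent_pair (grad g w) (grad f w) \<longrightarrow>
           skew_part (jacobian (switched_field f g \<epsilon> \<beta>) (at w)) \<noteq> 0)"
proof (intro allI conjI impI)
  fix w
  let ?F = "switched_field f g \<epsilon> \<beta>"
  let ?S = "hessian f w + sigmoid \<beta> (g w - \<epsilon>) *\<^sub>R (hessian g w - hessian f w)"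
  let ?c = "deriv (sigmoid \<beta>) (g w - \<epsilon>)" and ?B = "outer (grad g w - grad f w) (grad g w)"
  note D = has_derivative_switched_field[OF assms(1,2), of \<epsilon> \<beta> w]
  show "?F differentiable (at w)" using D by (rule differentiableI)
  show J: "jacobian ?F (at w) = ?S + ?c *\<^sub>R ?B"
    unfolding jacobian_def frechet_derivative_at[OF D, symmetric] by simp
  assume ind: "independent_pair (grad g w) (grad f w)"
  have "transpose ?S = ?S"
    using assms(1,2)[THEN transpose_hessian, of w] by (simp add: vec_eq_iff transpose_def)
  note skew = skew_part_symmetric_plus[OF this, of ?c ?B, folded J]
  show "skew_part (jacobian ?F (at w)) \<noteq> 0"
  proof
    assume "skew_part (jacobian ?F (at w)) = 0"
    then have "?B = transpose ?B"
      using skew deriv_sigmoid_pos[OF \<open>\<beta> > 0\<close>, of "g w - \<epsilon>"] by simp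
    then show False
      using outer_eq_transpose_imp_parallel independent_pair_not_parallel[OF ind] by blast
  qed
qed

end
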